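(* Let $C$ be a non-degenerate $\mathbb{F}_{q^m}$-$[n,k]$ rank-metric code and let $\mathcal{M}=\mathcal{M}[C]$ be the $q$-matroid induced by $C$. Then $\operatorname{crit}(\mathcal{M})=\left\lceil\frac{n}{m}\right\rceil$.
   Context: $q$ is a prime power, $n,m\ge2$. An $\mathbb{F}_{q^m}$-$[n,k]$ rank-metric (vector) code is a $k$-dimensional $\mathbb{F}_{q^m}$-subspace $C\le\mathbb{F}_{q^m}^n$. Fix an $\mathbb{F}_q$-basis $\Gamma$ of $\mathbb{F}_{q^m}$; for $x\in\mathbb{F}_{q^m}^n$, $\Gamma(x)\in\mathbb{F}_q^{n\times m}$ has $i$-th row the coordinates of $x_i$, and $\operatorname{supp}(x)$ is the column space of $\Gamma(x)$. $C$ is non-degenerate if $\sum_{x\in C}\operatorname{supp}(x)=\mathbb{F}_q^n$. $\mathcal{M}[C]$ is the $q$-matroid on the subspace lattice of $\mathbb{F}_q^n$ with rank $\rho(W)=k-\dim_{\mathbb{F}_{q^m}}\{x\in C:\operatorname{supp}(x)\le W^\perp\}$. Its critical exponent $\operatorname{crit}(\mathcal{M})$ is the least positive integer $t$ such that there exist $x_1,\ldots,x_t\in C$ with $\sum_{i=1}^t\operatorname{supp}(x_i)=\mathbb{F}_q^n$. *)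

theory Defs
  imports "HOL-Analysis.Cartesian_Space" "HOL-Library.Set_Algebras"
begin

(* F_q and F_{q^m} are finite field types 'q and 'K; the extension is given by an embedding
   \<iota> :: 'q => 'K.  Then q = CARD('q) is automatically a prime power, n = CARD('n), and
   m = CARD('m) is the size of an F_q-basis \<Gamma> of F_{q^m}.
   F_q- and F_{q^m}-linear algebra on row vectors is the library's interpretation vec. *)

definition field_embedding :: "('q::field \<Rightarrow> 'K::field) \<Rightarrow> bool" where
  "field_embedding \<iota> \<longleftrightarrow>
     \<iota> 1 = 1 \<and> (\<forall>a b. \<iota> (a + b) = \<iota> a + \<iota> b) \<and> (\<forall>a b. \<iota> (a * b) = \<iota> a * \<iota> b)"

definition ext_scale :: "('q::field \<Rightarrow> 'K::field) \<Rightarrow> 'q \<Rightarrow> 'K \<Rightarrow> 'K" where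
  "ext_scale \<iota> a y = \<iota> a * y"

lemma vector_space_ext_scale: "field_embedding \<iota> \<Longrightarrow> vector_space (ext_scale \<iota>)"
  by unfold_locales (auto simp: field_embedding_def ext_scale_def algebra_simps)

definition ext_basis :: "('q::field \<Rightarrow> 'K::field) \<Rightarrow> ('m \<Rightarrow> 'K) \<Rightarrow> bool" where
  "ext_basis \<iota> \<Gamma> \<longleftrightarrow>
     inj \<Gamma> \<and> \<not> module.dependent (ext_scale \<iota>) (range \<Gamma>) \<and>
     module.span (ext_scale \<iota>) (range \<Gamma>) = UNIV"

definition coord_matrix ::
  "('q::field \<Rightarrow> 'K::field) \<Rightarrow> ('m::finite \<Rightarrow> 'K) \<Rightarrow> 'K^'n \<Rightarrow> 'q^'m^'n" where
  "coord_matrix \<iota> \<Gamma> x =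
     (\<chi> i j. module.representation (ext_scale \<iota>) (range \<Gamma>) (x $ i) (\<Gamma> j))"

definition supp ::
  "('q::field \<Rightarrow> 'K::field) \<Rightarrow> ('m::finite \<Rightarrow> 'K) \<Rightarrow> 'K^'n \<Rightarrow> ('q^'n) set" where
  "supp \<iota> \<Gamma> x = vec.span (columns (coord_matrix \<iota> \<Gamma> x))"

definition rank_metric_code :: "('K::field^'n) set \<Rightarrow> nat \<Rightarrow> bool" where
  "rank_metric_code C k \<longleftrightarrow> vec.subspace C \<and> vec.dim C = k"

(* Sums of sets are the pointwise sums of Set_Algebras, i.e. sums of subspaces here;
   C is finite because the field 'K is. *)
definition nondegenerate ::
  "('q::field \<Rightarrow> 'K::{field,finite}) \<Rightarrow> ('m::finite \<Rightarrow> 'K) \<Rightarrow> ('K^'n) set \<Rightarrow> bool" where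
  "nondegenerate \<iota> \<Gamma> C \<longleftrightarrow> (\<Sum>x\<in>C. supp \<iota> \<Gamma> x) = UNIV"

definition orth_compl :: "('q::field^'n) set \<Rightarrow> ('q^'n) set" where
  "orth_compl W = {v. \<forall>w\<in>W. (\<Sum>i\<in>UNIV. v $ i * w $ i) = 0}"

(* A q-matroid is recorded by its ground space and its rank function, which is
   meaningful on the subspaces of the ground space only. *)
record 'v q_matroid =
  ground :: "'v set"
  rk :: "'v set \<Rightarrow> nat"

(* The difference does not truncate: the second term is the dimension of a subspace of C. *)
definition code_q_matroid ::
  "('q::field \<Rightarrow> 'K::field) \<Rightarrow> ('m::finite \<Rightarrow> 'K) \<Rightarrow> ('K^'n) set \<Rightarrow> ('q^'n) q_matroid" where
  "code_q_matroid \<iota> \<Gamma> C =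
     \<lparr>ground = UNIV,
      rk = (\<lambda>W. vec.dim C - vec.dim {x \<in> C. supp \<iota> \<Gamma> x \<subseteq> orth_compl W})\<rparr>"

(* The critical exponent of a q-matroid M induced by the code C, which is defined through
   the codewords of C; hence C is an argument alongside M.  (By the critical theorem for
   q-matroids the value is the same for every code over 'K inducing M.) *)
definition crit ::
  "('q::field \<Rightarrow> 'K::field) \<Rightarrow> ('m::finite \<Rightarrow> 'K) \<Rightarrow> ('K^'n) set \<Rightarrow> ('q^'n) q_matroid \<Rightarrow> nat" where
  "crit \<iota> \<Gamma> C M =
     (LEAST t. 0 < t \<and>
        (\<exists>x. (\<forall>i\<in>{1..t}. x i \<in> C) \<and> (\<Sum>i=1..t. supp \<iota> \<Gamma> (x i)) = ground M))"

end

theory Submission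
  imports Defs
begin

(* For w in F_q^n put pairing w x = w_1 x_1 + ... + w_n x_n in F_{q^m}.  A vector w is orthogonal
   to supp x iff pairing w x = 0, so the supports of x_1, ..., x_t sum to F_q^n iff no nonzero w
   pairs to zero with every x_i.
   If this holds, then w |-> (pairing w x_i)_i embeds F_q^n into F_{q^m}^t, so n <= m t.
   Conversely, for a non-degenerate C and w nonzero, pairing w is a nonzero F_{q^m}-linear
   functional on C, hence it kills all entries of exactly a proportion q^(-m t) of the t-tuples
   over C; as there are only q^n - 1 nonzero w, for n <= m t some t-tuple escapes all of them. *)

lemma left_kernel_trivial_imp_span_UNIV:
  fixes S :: "('q::{field,finite}^'n) set"
  assumes "\<And>w :: 'q^'n. (\<And>v. v \<in> S \<Longrightarrow> (\<Sum>i\<in>UNIV. w $ i * v $ i) = 0) \<Longrightarrow> w = 0"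
  shows "vec.span S = UNIV"
proof -
  (* Row rank = column rank is applied to a matrix whose columns are indexed by all vectors,
     so that no index type for S is needed. *)
  define A :: "'q^('q^'n)^'n" where "A = (\<chi> i v. if v \<in> S then v $ i else 0)"
  \<comment> \<open>The rows of \<open>A\<close> are independent: at an index \<open>v\<close> in
    \<open>S\<close>, a vanishing row combination says that \<open>c\<close> is orthogonal to
    \<open>v\<close>.\<close>
  have "\<forall>i. c i = 0" if c: "(\<Sum>i\<in>UNIV. c i *s row i A) = 0" for c
  proof -
    have "(\<chi> i. c i) = (0 :: 'q^'n)"
    proof (rule assms)
      fix v assume "v \<in> S"
      have "(\<Sum>i\<in>UNIV. c i *s row i A) $ v = 0" using c by simp
      then show "(\<Sum>i\<in>UNIV. (\<chi> i. c i) $ i * v $ i) = 0"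
        using \<open>v \<in> S\<close> by (simp add: row_def A_def)
    qed
    then show ?thesis by (simp add: vec_eq_iff)
  qed
  then have "vec.span (columns A) = UNIV"
    using matrix_right_invertible_independent_rows[of A]
      matrix_right_invertible_span_columns[of A] by blast
  \<comment> \<open>Indices outside \<open>S\<close> give zero columns; adjoining \<open>0\<close>
    does not change the span.\<close>
  moreover have "columns A \<subseteq> insert 0 S"
  proof
    fix y assume "y \<in> columns A"
    then obtain v where "y = column v A" by (auto simp: columns_def)
    moreover have "column v A = (if v \<in> S then v else 0)"
      by (simp add: column_def A_def vec_eq_iff)
    ultimately show "y \<in> insert 0 S" by simp
  qed
  ultimately have "vec.span (insert 0 S) = UNIV"
    using vec.span_mono by blast
  then show ?thesis by simp
qed

lemma subspace_set_sum:
  assumes "\<And>i. i \<in> I \<Longrightarrow> vec.subspace (S i :: ('q::field^'n) set)"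
  shows "vec.subspace (\<Sum>i\<in>I. S i)"
  using assms
proof (induction I rule: infinite_finite_induct)
  case (insert i I)
  have "S i + sum S I = {x + y |x y. x \<in> S i \<and> y \<in> sum S I}"
    by (auto simp: set_plus_def)
  with insert show ?case by (simp add: vec.subspace_sums)
\<comment> \<open>For empty or infinite \<open>I\<close> the sum is the neutral set
  \<open>{0}\<close>, which is a subspace.\<close>
qed (simp_all add: set_zero)

lemma subset_set_sum:
  fixes S :: "'i \<Rightarrow> 'a::comm_monoid_add set"
  assumes "finite I" "j \<in> I" "\<And>i. i \<in> I \<Longrightarrow> 0 \<in> S i"
  shows "S j \<subseteq> (\<Sum>i\<in>I. S i)"
proof
  fix v assume v: "v \<in> S j"
  let ?s = "\<lambda>i. if i = j then v else 0"
  have "v = sum ?s I" using assms by simp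
  moreover have "\<forall>i\<in>I. ?s i \<in> S i" using assms(3) v by simp
  ultimately show "v \<in> (\<Sum>i\<in>I. S i)"
    unfolding set_sum_alt[OF assms(1)] by blast
qed

lemma orthogonal_span:
  fixes w :: "'q::field^'n"
  assumes "\<And>v. v \<in> S \<Longrightarrow> (\<Sum>i\<in>UNIV. w $ i * v $ i) = 0" and "v \<in> vec.span S"
  shows "(\<Sum>i\<in>UNIV. w $ i * v $ i) = 0"
  using assms(2)
proof (induction rule: vec.span_induct_alt)
  case (step c x y)
  have "(\<Sum>i\<in>UNIV. w $ i * (c *s x + y) $ i)
      = c * (\<Sum>i\<in>UNIV. w $ i * x $ i) + (\<Sum>i\<in>UNIV. w $ i * y $ i)"
    by (simp add: algebra_simps sum.distrib sum_distrib_left)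
  with step assms(1) show ?case by simp
qed simp

text \<open>Since \<open>f\<close> is nonzero on \<open>C\<close>, the code splits as the direct sum
  of the kernel of \<open>f\<close> in \<open>C\<close> and a line over \<open>'K\<close>.\<close>

lemma card_functional_kernel:
  fixes C :: "('K::{field,finite}^'n) set"
  assumes C: "vec.subspace C"
    and add: "\<And>x y. f (x + y) = f x + f y" and scale: "\<And>c x. f (c *s x) = c * f x"
    and z: "z \<in> C" "f z \<noteq> 0"
  shows "card C = card {x \<in> C. f x = 0} * CARD('K)"
proof -
  \<comment> \<open>Normalised so that \<open>f e = 1\<close>: the component of \<open>x\<close>
    along \<open>e\<close> is then \<open>f x *s e\<close>.\<close>
  define e where "e = inverse (f z) *s z"
  have e: "e \<in> C" "f e = 1"
    using z C by (simp_all add: e_def vec.subspace_scale scale)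
  have diff: "f (x - c *s e) = f x - c" for x c
    using add[of "x - c *s e" "c *s e"] by (simp add: scale e)
  have "bij_betw (\<lambda>(y, c). y + c *s e) ({x \<in> C. f x = 0} \<times> (UNIV :: 'K set)) C"
  proof (rule bij_betwI[where g = "\<lambda>x. (x - f x *s e, f x)"])
    show "(\<lambda>(y, c). y + c *s e) \<in> {x \<in> C. f x = 0} \<times> UNIV \<rightarrow> C"
      using C e(1) by (auto intro: vec.subspace_add vec.subspace_scale)
    show "(\<lambda>x. (x - f x *s e, f x)) \<in> C \<rightarrow> {x \<in> C. f x = 0} \<times> UNIV"
      using C e(1) by (auto simp: diff intro: vec.subspace_diff vec.subspace_scale)
  qed (auto simp: add scale e(2))
  then have "card C = card ({x \<in> C. f x = 0} \<times> (UNIV :: 'K set))"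
    by (simp add: bij_betw_same_card)
  then show ?thesis by (simp add: card_cartesian_product)
qed

section \<open>Coordinates in the field extension\<close>

locale extension_basis =
  fixes \<iota> :: "'q::{field,finite} \<Rightarrow> 'K::{field,finite}"
    and \<Gamma> :: "'m::finite \<Rightarrow> 'K"
  assumes embedding: "field_embedding \<iota>"
    and basis: "ext_basis \<iota> \<Gamma>"
begin

interpretation ext: vector_space "ext_scale \<iota>"
  using embedding by (rule vector_space_ext_scale)

lemma \<iota>_simps: "\<iota> 1 = 1" "\<iota> (a + b) = \<iota> a + \<iota> b" "\<iota> (a * b) = \<iota> a * \<iota> b"
  using embedding by (auto simp: field_embedding_def)

lemma \<iota>_0: "\<iota> 0 = 0"
  using \<iota>_simps(2)[of 0 0] by (metis add_0 add_cancel_left_left)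

lemma \<iota>_sum: "\<iota> (sum f A) = (\<Sum>i\<in>A. \<iota> (f i))"
  by (induction A rule: infinite_finite_induct) (simp_all add: \<iota>_0 \<iota>_simps)

lemma \<iota>_diff: "\<iota> (a - b) = \<iota> a - \<iota> b"
  using \<iota>_simps(2)[of "a - b" b] by simp

lemma basis_independent:
  assumes "(\<Sum>j\<in>UNIV. \<iota> (a j) * \<Gamma> j) = 0"
  shows "a j = 0"
proof -
  have inj: "inj \<Gamma>" and ind: "ext.independent (range \<Gamma>)"
    using basis by (auto simp: ext_basis_def)
  \<comment> \<open>Independence concerns coefficients on the set \<open>range \<Gamma>\<close>;
    \<open>inv \<Gamma>\<close> carries the indexed family over to it.\<close>
  have "(\<Sum>v\<in>range \<Gamma>. ext_scale \<iota> (a (inv \<Gamma> v)) v) = 0"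
    using assms inj by (simp add: sum.reindex ext_scale_def)
  then have "a (inv \<Gamma> (\<Gamma> j)) = 0"
    using ext.independentD[OF ind, of "range \<Gamma>" "\<lambda>v. a (inv \<Gamma> v)" "\<Gamma> j"] by simp
  then show ?thesis using inj by simp
qed

lemma basis_representation:
  "(\<Sum>j\<in>UNIV. \<iota> (ext.representation (range \<Gamma>) y (\<Gamma> j)) * \<Gamma> j) = y"
proof -
  have inj: "inj \<Gamma>" and ind: "ext.independent (range \<Gamma>)"
    and span: "y \<in> ext.span (range \<Gamma>)"
    using basis by (auto simp: ext_basis_def)
  have "(\<Sum>v\<in>range \<Gamma>. ext_scale \<iota> (ext.representation (range \<Gamma>) y v) v) = y"
    using ext.sum_representation_eq[OF ind span] by simp
  then show ?thesis using inj by (simp add: sum.reindex ext_scale_def)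
qed

text \<open>Coordinates with respect to \<open>\<Gamma>\<close> identify \<open>'K\<close> with
  \<open>'q^'m\<close>.\<close>

lemma card_extension: "CARD('K) = CARD('q) ^ CARD('m)"
proof -
  have "bij (\<lambda>a :: 'q^'m. \<Sum>j\<in>UNIV. \<iota> (a $ j) * \<Gamma> j)"
  proof (rule bijI)
    show "inj (\<lambda>a :: 'q^'m. \<Sum>j\<in>UNIV. \<iota> (a $ j) * \<Gamma> j)"
    proof (rule injI)
      fix a b :: "'q^'m"
      assume "(\<Sum>j\<in>UNIV. \<iota> (a $ j) * \<Gamma> j) = (\<Sum>j\<in>UNIV. \<iota> (b $ j) * \<Gamma> j)"
      then have "(\<Sum>j\<in>UNIV. \<iota> (a $ j - b $ j) * \<Gamma> j) = 0"
        by (simp add: \<iota>_diff left_diff_distrib sum_subtractf)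
      then show "a = b"
        using basis_independent[of "\<lambda>j. a $ j - b $ j"] by (simp add: vec_eq_iff)
    qed
    show "surj (\<lambda>a :: 'q^'m. \<Sum>j\<in>UNIV. \<iota> (a $ j) * \<Gamma> j)"
    proof (rule surjI)
      show "(\<Sum>j\<in>UNIV. \<iota> ((\<chi> j. ext.representation (range \<Gamma>) y (\<Gamma> j)) $ j) * \<Gamma> j) = y" for y
        by (simp add: basis_representation)
    qed
  qed
  then have "CARD('q^'m) = CARD('K)" by (rule bij_betw_same_card)
  then show ?thesis by simp
qed

text \<open>The dot product with the scalars of \<open>w\<close> extended along
  \<open>\<iota>\<close>. It is linear over \<open>'q\<close> in \<open>w\<close> but over
  \<open>'K\<close> in \<open>x\<close>, so that each \<open>w\<close> gives a functional on the
  code.\<close>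

definition pairing :: "'q^'n \<Rightarrow> 'K^'n \<Rightarrow> 'K" where
  "pairing w x = (\<Sum>i\<in>UNIV. \<iota> (w $ i) * x $ i)"

lemma pairing_diff_left: "pairing (v - w) x = pairing v x - pairing w x"
  by (simp add: pairing_def \<iota>_diff left_diff_distrib sum_subtractf)

lemma pairing_add_right: "pairing w (x + y) = pairing w x + pairing w y"
  by (simp add: pairing_def algebra_simps sum.distrib)

lemma pairing_scale_right: "pairing w (c *s x) = c * pairing w x"
  by (simp add: pairing_def algebra_simps sum_distrib_left)

text \<open>The coordinate of \<open>pairing w x\<close> at \<open>\<Gamma> j\<close> is the dot
  product of \<open>w\<close> with column \<open>j\<close> of the coordinate matrix, and these
  columns span the support.\<close>

lemma pairing_eq_0_iff:
  "pairing w x = 0 \<longleftrightarrow> (\<forall>v\<in>supp \<iota> \<Gamma> x. (\<Sum>i\<in>UNIV. w $ i * v $ i) = 0)"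
proof -
  define A where "A = coord_matrix \<iota> \<Gamma> x"
  have "pairing w x = (\<Sum>i\<in>UNIV. \<iota> (w $ i) * (\<Sum>j\<in>UNIV. \<iota> (A $ i $ j) * \<Gamma> j))"
    by (simp add: pairing_def A_def coord_matrix_def basis_representation)
  also have "\<dots> = (\<Sum>i\<in>UNIV. \<Sum>j\<in>UNIV. \<iota> (w $ i * A $ i $ j) * \<Gamma> j)"
    by (simp add: sum_distrib_left \<iota>_simps mult.assoc)
  also have "\<dots> = (\<Sum>j\<in>UNIV. \<iota> (\<Sum>i\<in>UNIV. w $ i * A $ i $ j) * \<Gamma> j)"
    by (subst sum.swap) (simp add: sum_distrib_right \<iota>_sum)
  finally have eq: "pairing w x = \<dots>" .
  have "pairing w x = 0 \<longleftrightarrow> (\<forall>j. (\<Sum>i\<in>UNIV. w $ i * A $ i $ j) = 0)"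
    unfolding eq using basis_independent[of "\<lambda>j. \<Sum>i\<in>UNIV. w $ i * A $ i $ j"]
    by (auto simp: \<iota>_0)
  also have "\<dots> \<longleftrightarrow> (\<forall>v\<in>columns A. (\<Sum>i\<in>UNIV. w $ i * v $ i) = 0)"
    by (auto simp: columns_def column_def)
  also have "\<dots> \<longleftrightarrow> (\<forall>v\<in>supp \<iota> \<Gamma> x. (\<Sum>i\<in>UNIV. w $ i * v $ i) = 0)"
    unfolding supp_def A_def[symmetric] using orthogonal_span vec.span_base by blast
  finally show ?thesis .
qed

section \<open>Families of vectors whose supports sum to the whole space\<close>

lemma subspace_supp: "vec.subspace (supp \<iota> \<Gamma> x)"
  by (simp add: supp_def)

text \<open>A subspace is everything iff only zero is orthogonal to it, and orthogonality to a sum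
  can be tested on the summands. The index set is general because both \<open>{1..t}\<close> and
  \<open>C\<close> itself are used later.\<close>

lemma sum_supp_eq_UNIV_iff:
  fixes x :: "'i \<Rightarrow> 'K^'n"
  assumes "finite I"
  shows "(\<Sum>i\<in>I. supp \<iota> \<Gamma> (x i)) = UNIV \<longleftrightarrow> (\<forall>w. (\<forall>i\<in>I. pairing w (x i) = 0) \<longrightarrow> w = 0)"
    (is "?W = UNIV \<longleftrightarrow> ?R")
proof
  assume W: "?W = UNIV"
  show ?R
  proof (intro allI impI)
    fix w assume w: "\<forall>i\<in>I. pairing w (x i) = 0"
    show "w = 0"
      unfolding vec_eq_iff
    proof
      fix l
      \<comment> \<open>Splitting a unit vector among the supports turns the entry
        \<open>w $ l\<close> into a sum of dot products that all vanish.\<close>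
      have "axis l 1 \<in> ?W" using W by simp
      then obtain s where s: "axis l 1 = sum s I" "\<And>i. i \<in> I \<Longrightarrow> s i \<in> supp \<iota> \<Gamma> (x i)"
        unfolding set_sum_alt[OF assms] by auto
      have "w $ l = (\<Sum>j\<in>UNIV. w $ j * axis l 1 $ j)"
        by (simp add: axis_def if_distrib cong: if_cong)
      also have "\<dots> = (\<Sum>i\<in>I. \<Sum>j\<in>UNIV. w $ j * s i $ j)"
        unfolding s(1) by (subst sum.swap) (simp add: sum_distrib_left)
      also have "\<dots> = 0" using w s(2) by (simp add: pairing_eq_0_iff)
      finally show "w $ l = 0 $ l" by simp
    qed
  qed
next
  assume R: ?R
  have sub: "supp \<iota> \<Gamma> (x i) \<subseteq> ?W" if "i \<in> I" for i
    using subset_set_sum[of I i "\<lambda>i. supp \<iota> \<Gamma> (x i)"] assms that subspace_supp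
    by (metis vec.subspace_0)
  have "vec.span ?W = UNIV"
  proof (rule left_kernel_trivial_imp_span_UNIV)
    fix w :: "'q^'n"
    assume "\<And>v. v \<in> ?W \<Longrightarrow> (\<Sum>i\<in>UNIV. w $ i * v $ i) = 0"
    with sub have "\<forall>i\<in>I. pairing w (x i) = 0"
      unfolding pairing_eq_0_iff by blast
    with R show "w = 0" by blast
  qed
  moreover have "vec.subspace ?W"
    by (intro subspace_set_sum subspace_supp)
  ultimately show "?W = UNIV"
    using vec.span_eq_iff by blast
qed

lemma sum_supp_eq_UNIV_imp_le:
  fixes x :: "nat \<Rightarrow> 'K^'n"
  assumes "(\<Sum>i=1..t. supp \<iota> \<Gamma> (x i)) = UNIV"
  shows "CARD('n) \<le> CARD('m) * t"
proof -
  \<comment> \<open>The restricted abstraction makes the values extensional, so that they lie in a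
    finite \<open>PiE\<close> of \<open>CARD('K) ^ t\<close> elements.\<close>
  let ?f = "\<lambda>w. \<lambda>i\<in>{1..t}. pairing w (x i)"
  have "inj ?f"
  proof (rule injI)
    fix v w assume "?f v = ?f w"
    then have "pairing (v - w) (x i) = 0" if "i \<in> {1..t}" for i
      using that by (auto simp: pairing_diff_left dest: fun_cong[where x = i])
    then have "v - w = 0"
      using assms sum_supp_eq_UNIV_iff[of "{1..t}" x] by blast
    then show "v = w" by simp
  qed
  then have "CARD('q^'n) \<le> card (PiE {1..t} (\<lambda>_. UNIV :: 'K set))"
    by (intro card_inj_on_le[of ?f]) (auto intro: finite_PiE)
  then have "CARD('q) ^ CARD('n) \<le> CARD('q) ^ (CARD('m) * t)"
    by (simp add: card_PiE card_extension power_mult)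
  moreover have "1 < CARD('q)"
    using card_mono[of UNIV "{0, 1 :: 'q}"] by simp
  ultimately show ?thesis by simp
qed

lemma exists_sum_supp_eq_UNIV:
  fixes C :: "('K^'n) set"
  assumes C: "vec.subspace C" and nondeg: "nondegenerate \<iota> \<Gamma> C"
    and t: "CARD('n) \<le> CARD('m) * t"
  shows "\<exists>x. (\<forall>i\<in>{1..t}. x i \<in> C) \<and> (\<Sum>i=1..t. supp \<iota> \<Gamma> (x i)) = UNIV"
proof -
  \<comment> \<open>The tuples of codewords for which \<open>w\<close> obstructs the supports from
    summing to the whole space.\<close>
  define Z where "Z w = PiE {1..t} (\<lambda>_. {x \<in> C. pairing w x = 0})" for w
  let ?T = "PiE {1..t} (\<lambda>_. C)"
  have card_Z: "card (Z w) * CARD('K) ^ t = card C ^ t" if "w \<noteq> 0" for w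
  proof -
    \<comment> \<open>Non-degeneracy is the support criterion for the family of all
      codewords.\<close>
    have "\<forall>w. (\<forall>z\<in>C. pairing w z = 0) \<longrightarrow> w = 0"
      using nondeg sum_supp_eq_UNIV_iff[of C "\<lambda>x. x"] by (simp add: nondegenerate_def)
    with that obtain z where "z \<in> C" "pairing w z \<noteq> 0" by blast
    then have "card C = card {x \<in> C. pairing w x = 0} * CARD('K)"
      by (intro card_functional_kernel) (simp_all add: C pairing_add_right pairing_scale_right)
    then show ?thesis by (simp add: Z_def card_PiE power_mult_distrib)
  qed
  \<comment> \<open>Union bound, multiplied by \<open>CARD('K) ^ t\<close> so that no proportions
    have to be divided out.\<close>
  have "card (\<Union>w\<in>- {0}. Z w) * CARD('K) ^ t \<le> (\<Sum>w\<in>- {0}. card (Z w)) * CARD('K) ^ t"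
    by (intro mult_right_mono card_UN_le) simp_all
  also have "\<dots> = card (- {0 :: 'q^'n}) * card C ^ t"
    by (simp add: sum_distrib_right card_Z)
  also have "\<dots> < CARD('K) ^ t * card C ^ t"
  proof (intro mult_strict_right_mono)
    \<comment> \<open>Leaving out \<open>w = 0\<close> makes the bound strict even when
      \<open>CARD('n) = CARD('m) * t\<close>.\<close>
    have "card (- {0 :: 'q^'n}) < CARD('q^'n)"
      by (rule psubset_card_mono) auto
    also have "\<dots> \<le> CARD('q) ^ (CARD('m) * t)"
      using t by (simp add: power_increasing)
    finally show "card (- {0 :: 'q^'n}) < CARD('K) ^ t"
      by (simp add: card_extension power_mult)
    show "0 < card C ^ t"
      using vec.subspace_0[OF C] by (auto simp: card_gt_0_iff)
  qed
  finally have "card (\<Union>w\<in>- {0}. Z w) < card ?T"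
    by (simp add: card_PiE)
  moreover have "finite (\<Union>w\<in>- {0}. Z w)"
    by (intro finite_UN_I finite) (simp add: Z_def finite_PiE)
  ultimately have "\<not> ?T \<subseteq> (\<Union>w\<in>- {0}. Z w)"
    using card_mono leD by blast
  then obtain x where x: "x \<in> ?T" "\<And>w. w \<noteq> 0 \<Longrightarrow> x \<notin> Z w" by auto
  have "(\<Sum>i=1..t. supp \<iota> \<Gamma> (x i)) = UNIV"
    using x by (subst sum_supp_eq_UNIV_iff) (auto simp: Z_def PiE_iff)
  with x(1) show ?thesis by (auto simp: PiE_iff)
qed

end

theorem theorem5p3:
  fixes \<iota> :: "'q::{field,finite} \<Rightarrow> 'K::{field,finite}"
    and \<Gamma> :: "'m::finite \<Rightarrow> 'K"
    and C :: "('K^'n) set"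
    and k :: nat
    and M :: "('q^'n) q_matroid"
  assumes "CARD('n) \<ge> 2" and "CARD('m) \<ge> 2"
    and "field_embedding \<iota>"
    and "ext_basis \<iota> \<Gamma>"
    and "rank_metric_code C k"
    and "nondegenerate \<iota> \<Gamma> C"
    and "M = code_q_matroid \<iota> \<Gamma> C"
  shows "int (crit \<iota> \<Gamma> C M) = \<lceil>real CARD('n) / real CARD('m)\<rceil>"
proof -
  interpret extension_basis \<iota> \<Gamma>
    using assms by unfold_locales
  let ?r = "real CARD('n) / real CARD('m)"
  have C: "vec.subspace C" and ground: "ground M = UNIV"
    using assms by (simp_all add: rank_metric_code_def code_q_matroid_def)
  \<comment> \<open>Positivity makes the ceiling an admissible exponent, and \<open>nat\<close>
    leaves it unchanged.\<close>
  have pos: "0 < ?r" by simp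
  \<comment> \<open>Turns the condition shared by the necessary and the sufficient direction into a
    lower bound on \<open>t\<close>.\<close>
  have le_iff: "CARD('n) \<le> CARD('m) * t \<longleftrightarrow> nat \<lceil>?r\<rceil> \<le> t" for t
  proof -
    have "CARD('n) \<le> CARD('m) * t \<longleftrightarrow> real CARD('n) \<le> real t * real CARD('m)"
      by (metis mult.commute of_nat_le_iff of_nat_mult)
    also have "\<dots> \<longleftrightarrow> ?r \<le> real t" by (simp add: pos_divide_le_eq)
    also have "\<dots> \<longleftrightarrow> nat \<lceil>?r\<rceil> \<le> t" by (simp add: nat_le_iff ceiling_le_iff)
    finally show ?thesis .
  qed
  have "crit \<iota> \<Gamma> C M = nat \<lceil>?r\<rceil>"
    unfolding crit_def ground
  proof (rule Least_equality, intro conjI)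
    show "0 < nat \<lceil>?r\<rceil>" using pos by simp
    show "\<exists>x. (\<forall>i\<in>{1..nat \<lceil>?r\<rceil>}. x i \<in> C) \<and>
        (\<Sum>i=1..nat \<lceil>?r\<rceil>. supp \<iota> \<Gamma> (x i)) = UNIV"
      using assms by (intro exists_sum_supp_eq_UNIV C) (simp_all add: le_iff)
  next
    fix t :: nat
    assume "0 < t \<and> (\<exists>x. (\<forall>i\<in>{1..t}. x i \<in> C) \<and> (\<Sum>i=1..t. supp \<iota> \<Gamma> (x i)) = UNIV)"
    then show "nat \<lceil>?r\<rceil> \<le> t"
      using sum_supp_eq_UNIV_imp_le le_iff by blast
  qed
  moreover have "0 \<le> \<lceil>?r\<rceil>"
    using pos by linarith
  ultimately show ?thesis by simp
qed

end
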